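(* Let $N\ge 3$ and let $f$ satisfy the standing assumptions given in the context. If $u(\cdot,\alpha)$ is stable for some $\alpha>0$, then $r_0(\alpha)=\infty$. Moreover, one of the following (I)–(III) holds. (I) For any $\alpha>0$, $u(r,\alpha)$ is unstable. (II) For any $\alpha>0$, $u(r,\alpha)$ is stable. In this case, $u(r,\alpha)$ is strictly increasing in $\alpha>0$ for each fixed $r>0$. (III) There exists $\alpha^*\in(0,\infty)$ such that $u(r,\alpha)$ is stable if $\alpha\in(0,\alpha^*]$, and $u(r,\alpha)$ is unstable if $\alpha>\alpha^*$. In this case, $u(r,\alpha)$ is strictly increasing in $\alpha\in(0,\alpha^* )$ for each fixed $r>0$.
   Context: $N\ge 3$ is an integer. Standing assumptions on $f:\mathbb{R}\to\mathbb{R}$: $f\in C^2(\mathbb{R}\setminus\{0\})\cap C^1(\mathbb{R})$; $f$ is odd (so $f(0)=0$); and for all $u>0$, $f(u)>0$, $f'(u)>0$, $f''(u)>0$ and $F(u):=\int_u^\infty \frac{ds}{f(s)}<\infty$. For $\alpha>0$, $u(r,\alpha)$ denotes the unique solution of $u''+\frac{N-1}{r}u'+f(u)=0$ for $r>0$, $u(0)=\alpha$, $u'(0)=0$. $r_0(\alpha)$ denotes the first zero of $u(\cdot,\alpha)$ in $[0,\infty)$, with $r_0(\alpha)=\infty$ if $u(r,\alpha)>0$ for all $r\ge 0$. A solution $u\in C^2(\mathbb{R}^N)$ of $\Delta u+f(u)=0$ in $\mathbb{R}^N$ is called stable if $\int_{\mathbb{R}^N}(|\nabla\phi|^2-f'(u)\phi^2)\,dx\ge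 0$ for every $\phi\in C^1_0(\mathbb{R}^N)$ ($C^1$ functions with compact support), and unstable if it is not stable. We say $u(r,\alpha)$ is stable (unstable) if $x\mapsto u(|x|,\alpha)$ is. *)

theory Defs
  imports "HOL-Analysis.Analysis"
begin

definition admissible_nonlinearity :: "(real \<Rightarrow> real) \<Rightarrow> bool" where
  "admissible_nonlinearity f \<longleftrightarrow>
     f differentiable_on UNIV \<and> continuous_on UNIV (deriv f) \<and>
     deriv f differentiable_on (- {0}) \<and> continuous_on (- {0}) (deriv (deriv f)) \<and>
     (\<forall>u. f (- u) = - f u) \<and>
     (\<forall>u>0. f u > 0 \<and> deriv f u > 0 \<and> deriv (deriv f) u > 0 \<and>
            (\<integral>\<^sup>+s\<in>{u..}. ennreal (1 / f s) \<partial>lborel) < \<infinity>)"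

text \<open>Only the values of \<open>u\<close> on \<open>[0, \<infinity>)\<close> matter; the derivative at \<open>0\<close> is
  one-sided. Continuity of \<open>u''\<close> on \<open>(0, \<infinity>)\<close> follows from the equation.\<close>

definition radial_solution :: "nat \<Rightarrow> (real \<Rightarrow> real) \<Rightarrow> real \<Rightarrow> (real \<Rightarrow> real) \<Rightarrow> bool" where
  "radial_solution N f \<alpha> u \<longleftrightarrow>
     (\<exists>u' u''.
        (\<forall>r\<ge>0. (u has_real_derivative u' r) (at r within {0..})) \<and>
        (\<forall>r>0. (u' has_real_derivative u'' r) (at r) \<and>
               u'' r + (real N - 1) / r * u' r + f (u r) = 0) \<and>
        u 0 = \<alpha> \<and> u' 0 = 0)"

text \<open>The infimum of the empty set is \<open>\<infinity>\<close>; for continuous \<open>u\<close> a finite infimum is attained.\<close>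

definition first_zero :: "(real \<Rightarrow> real) \<Rightarrow> ereal" where
  "first_zero u = (INF r\<in>{r. 0 \<le> r \<and> u r = 0}. ereal r)"

text \<open>Both notions are meant for solutions \<open>u\<close> of \<open>\<Delta>u + f(u) = 0\<close>.
  The pair \<open>\<phi>, g\<close> ranges over the \<open>C\<^sup>1\<close> functions with compact support and their gradients.\<close>

definition stable_solution :: "(real \<Rightarrow> real) \<Rightarrow> (real ^ 'n \<Rightarrow> real) \<Rightarrow> bool" where
  "stable_solution f u \<longleftrightarrow>
     (\<forall>\<phi> g. (\<forall>x. GDERIV \<phi> x :> g x) \<and> continuous_on UNIV g \<and>
            compact (closure {x. \<phi> x \<noteq> 0}) \<longrightarrow>
        0 \<le> (\<integral>x. ((norm (g x))\<^sup>2 - deriv f (u x) * (\<phi> x)\<^sup>2) \<partial>lborel))"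

definition unstable_solution :: "(real \<Rightarrow> real) \<Rightarrow> (real ^ 'n \<Rightarrow> real) \<Rightarrow> bool" where
  "unstable_solution f u \<longleftrightarrow> \<not> stable_solution f u"

end

theory Submission
  imports Defs
begin

text \<open>
  Stability of \<open>w = u(\<cdot>,\<beta>)\<close> forbids a radial \<open>v\<close> that is positive on a ball, vanishes on its
  boundary and satisfies \<open>- \<Delta>v < f'(w) v\<close> inside, because testing with \<open>v\<close> makes the quadratic form
  negative. By strict convexity of \<open>f\<close> on \<open>(0, \<infinity>)\<close>, such a \<open>v\<close> would be \<open>w\<close> itself if \<open>w\<close> had a zero;
  and for \<open>\<alpha> < \<beta>\<close> it would be \<open>u(\<cdot>,\<alpha>)\<close> or \<open>w - u(\<cdot>,\<alpha>)\<close>, whichever vanishes first. Hence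
  \<open>0 < u(\<cdot>,\<alpha>) < u(\<cdot>,\<beta>)\<close>, and as \<open>f'\<close> is increasing on \<open>[0, \<infinity>)\<close> the stability of \<open>u(\<cdot>,\<beta>)\<close> passes to
  \<open>u(\<cdot>,\<alpha>)\<close>. So the set of stable \<open>\<alpha>\<close> is an initial segment of \<open>(0, \<infinity>)\<close>, and continuous dependence
  on \<open>\<alpha>\<close> shows that it contains its supremum.
\<close>

section \<open>Radial functions on a Euclidean space: integrals and gradients\<close>

text \<open>Polar coordinates for the norm alone. The half-lines \<open>{..a}\<close> are stable
  under intersection and generate the Borel sets, so it is enough to compare the measures there: one
  side is the volume of a ball of radius \<open>a\<close>, the other is computed from the
  antiderivative \<open>c * a ^ DIM('a)\<close>.\<close>

lemma distr_norm_lborel: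
  "distr (lborel :: 'a::euclidean_space measure) borel norm =
     density lborel (\<lambda>r. ennreal (indicator {0..} r *
       (real DIM('a) * unit_ball_vol DIM('a) * r ^ (DIM('a) - 1))))" (is "?M = ?D")
proof -
  define c where "c = unit_ball_vol DIM('a)"
  have c: "c \<ge> 0"
    unfolding c_def by (rule unit_ball_vol_nonneg) simp
  have M: "emeasure ?M {..a} = ennreal (if a \<ge> 0 then c * a ^ DIM('a) else 0)" for a
  proof -
    have "emeasure ?M {..a} = emeasure lborel (cball (0::'a) a)"
      by (subst emeasure_distr) (auto intro!: arg_cong[where f = "emeasure lborel"])
    then show ?thesis
      by (auto simp: emeasure_cball c_def)
  qed
  have D: "emeasure ?D {..a} = ennreal (if a \<ge> 0 then c * a ^ DIM('a) else 0)" for a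
  proof -
    have "emeasure ?D {..a} = (\<integral>\<^sup>+r. ennreal (indicator {0..} r *
        (real DIM('a) * c * r ^ (DIM('a) - 1))) * indicator {..a} r \<partial>lborel)"
      unfolding c_def by (rule emeasure_density) auto
    also have "\<dots> = (\<integral>\<^sup>+r. ennreal (real DIM('a) * c * r ^ (DIM('a) - 1)) * indicator {0..a} r \<partial>lborel)"
      by (rule nn_integral_cong) (auto simp: indicator_def)
    also have "\<dots> = ennreal (if a \<ge> 0 then c * a ^ DIM('a) else 0)"
    proof (cases "a \<ge> 0")
      case True
      have "(\<integral>\<^sup>+r. ennreal (real DIM('a) * c * r ^ (DIM('a) - 1)) * indicator {0..a} r \<partial>lborel)
          = ennreal (c * a ^ DIM('a) - c * 0 ^ DIM('a))"
        by (rule nn_integral_FTC_Icc)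
           (use True c in \<open>auto intro!: derivative_eq_intros\<close>)
      then show ?thesis using True by (simp add: zero_power)
    qed simp
    finally show ?thesis .
  qed
  show ?thesis
  proof (rule measure_eqI_generator_eq)
    show "Int_stable (range atMost :: real set set)"
      by (auto simp: Int_stable_def)
    show "emeasure ?M X = emeasure ?D X" if "X \<in> range atMost" for X
      using that M D by auto
    show "sets ?M = sigma_sets UNIV (range atMost)" "sets ?D = sigma_sets UNIV (range atMost)"
      by (simp_all add: borel_eq_atMost)
    show "range (\<lambda>i. {..real i}) \<subseteq> range atMost" by auto
    show "(\<Union>i. {..real i}) = UNIV" by (auto simp: real_arch_simple)
    show "emeasure ?M {..real i} \<noteq> \<infinity>" for i by (simp add: M)
  qed auto
qed

lemma integral_radial:
  fixes H :: "real \<Rightarrow> real"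
  assumes cont: "continuous_on {0..R} H" and zero: "\<And>r. r > R \<Longrightarrow> H r = 0"
  shows "(\<integral>x. H (norm (x::'a::euclidean_space)) \<partial>lborel) =
    real DIM('a) * unit_ball_vol DIM('a) * integral {0..R} (\<lambda>r. r ^ (DIM('a) - 1) * H r)"
proof -
  define C where "C = real DIM('a) * unit_ball_vol DIM('a)"
  have C: "C \<ge> 0"
    unfolding C_def using unit_ball_vol_nonneg[of "DIM('a)"] by simp
  \<comment> \<open>\<open>H\<close> is arbitrary on the negative reals. Cutting it off outside
    \<open>{0..R}\<close> makes it Borel measurable and changes nothing at values of the
    norm.\<close>
  define J where "J = (\<lambda>r. indicator {0..R} r *\<^sub>R H r)"
  have J [measurable]: "J \<in> borel_measurable borel"
    using borel_measurable_continuous_on_indicator[OF _ cont] by (simp add: J_def)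
  have "(\<integral>x. H (norm (x::'a)) \<partial>lborel) = (\<integral>x. J (norm (x::'a)) \<partial>lborel)"
    by (rule arg_cong2[where f = "integral\<^sup>L", OF refl])
       (auto simp: fun_eq_iff J_def indicator_def zero not_le)
  also have "\<dots> = integral\<^sup>L (distr (lborel :: 'a measure) borel norm) J"
    by (rule integral_distr[symmetric]) auto
  also have "\<dots> = (\<integral>r. (indicator {0..} r * (C * r ^ (DIM('a) - 1))) *\<^sub>R J r \<partial>lborel)"
    unfolding distr_norm_lborel C_def[symmetric]
    by (rule integral_density) (use C in \<open>auto simp: indicator_def\<close>)
  also have "\<dots> = (\<integral>r. C * (indicator {0..R} r *\<^sub>R (r ^ (DIM('a) - 1) * H r)) \<partial>lborel)"
    by (rule Bochner_Integration.integral_cong) (auto simp: J_def indicator_def)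
  also have "\<dots> = C * (LINT r:{0..R}|lborel. r ^ (DIM('a) - 1) * H r)"
    by (simp add: set_lebesgue_integral_def)
  also have "(LINT r:{0..R}|lborel. r ^ (DIM('a) - 1) * H r) = integral {0..R} (\<lambda>r. r ^ (DIM('a) - 1) * H r)"
    by (intro set_borel_integral_eq_integral borel_integrable_atLeastAtMost' continuous_intros cont)
  finally show ?thesis by (simp add: C_def)
qed

text \<open>Away from the origin this is the chain rule. At the origin the norm is not
  differentiable, but \<open>\<Phi>' 0 = 0\<close> makes the difference quotient along the norm tend
  to zero, and the right-hand side is zero there as well.\<close>

lemma GDERIV_radial:
  fixes x :: "'a::euclidean_space"
  assumes \<Phi>: "\<And>r. r \<ge> 0 \<Longrightarrow> (\<Phi> has_real_derivative \<Phi>' r) (at r within {0..})"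
    and \<Phi>'0: "\<Phi>' 0 = 0"
  shows "GDERIV (\<lambda>x. \<Phi> (norm x)) x :> \<Phi>' (norm x) *\<^sub>R sgn x"
proof (cases "x = 0")
  case False
  then have "(\<Phi> has_real_derivative \<Phi>' (norm x)) (at (norm x) within {0..})"
    using \<Phi> by simp
  moreover have "at (norm x) within {0..} = at (norm x)"
    using False by (intro at_within_interior) auto
  ultimately show ?thesis
    using GDERIV_DERIV_compose[OF GDERIV_norm[OF False], of \<Phi>] by simp
next
  case True
  have "((\<lambda>r. (\<Phi> r - \<Phi> 0) / (r - 0)) \<longlongrightarrow> 0) (at 0 within {0..})"
    using \<Phi>[of 0] \<Phi>'0 by (simp add: has_field_derivative_iff)
  then have "((\<lambda>r. norm (\<Phi> r - \<Phi> 0) / norm r) \<longlongrightarrow> 0) (at 0 within {0..})"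
    using tendsto_norm_zero by (fastforce simp: norm_divide)
  moreover have "filterlim (norm :: 'a \<Rightarrow> real) (at 0 within {0..}) (at 0)"
    by (auto simp: filterlim_at eventually_at_filter intro!: tendsto_eq_intros)
  ultimately have "((\<lambda>y::'a. norm (\<Phi> (norm y) - \<Phi> 0) / norm (norm y)) \<longlongrightarrow> 0) (at 0)"
    by (rule filterlim_compose)
  then have "((\<lambda>y::'a. \<Phi> (norm y)) has_derivative (\<lambda>h. 0)) (at 0)"
    by (simp add: has_derivative_iff_norm bounded_linear_zero)
  then show ?thesis
    using True by (simp add: gderiv_def)
qed

text \<open>The direction \<open>sgn x\<close> jumps at the origin but stays bounded, and its factor
  tends to zero there.\<close>

lemma continuous_on_radial_gradient:
  assumes "continuous_on {0..} \<Phi>'" and "\<Phi>' 0 = (0::real)"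
  shows "continuous_on UNIV (\<lambda>x::'a::euclidean_space. \<Phi>' (norm x) *\<^sub>R sgn x)"
proof -
  have comp: "continuous_on UNIV (\<lambda>x::'a. \<Phi>' (norm x))"
    by (rule continuous_on_compose2[OF assms(1)]) (auto intro!: continuous_intros)
  have "isCont (\<lambda>x::'a. \<Phi>' (norm x) *\<^sub>R sgn x) x" for x
  proof (cases "x = 0")
    case False
    moreover have "isCont (\<lambda>x::'a. \<Phi>' (norm x)) x"
      using comp by (simp add: continuous_on_eq_continuous_at)
    ultimately show ?thesis
      unfolding sgn_div_norm by (intro continuous_intros) auto
  next
    case True
    have "isCont (\<lambda>x::'a. \<Phi>' (norm x)) 0"
      using comp by (simp add: continuous_on_eq_continuous_at)
    then have lim: "((\<lambda>x::'a. \<Phi>' (norm x)) \<longlongrightarrow> 0) (at 0)"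
      using assms(2) by (simp add: isCont_def)
    have "((\<lambda>x::'a. \<Phi>' (norm x) *\<^sub>R sgn x) \<longlongrightarrow> 0) (at 0)"
      by (rule Lim_null_comparison[OF _ tendsto_norm_zero[OF lim]])
         (simp add: eventually_at_filter norm_sgn)
    with True show ?thesis
      by (simp add: isCont_def)
  qed
  then show ?thesis
    by (simp add: continuous_on_eq_continuous_at)
qed

section \<open>The radial Poisson equation and regularity at the origin\<close>

text \<open>The radial form of \<open>- \<Delta>v = g\<close> in dimension \<open>n + 1\<close>.\<close>

locale radial_poisson =
  fixes n :: nat and v v' g :: "real \<Rightarrow> real"
  assumes n_pos: "n > 0"
    and deriv_v: "\<And>r. r \<ge> 0 \<Longrightarrow> (v has_real_derivative v' r) (at r within {0..})"
    and deriv_v': "\<And>r. r > 0 \<Longrightarrow> (v' has_real_derivative - (real n / r * v' r) - g r) (at r)"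
    and v'_0: "v' 0 = 0"
    and cont_g: "continuous_on {0..} g"
begin

lemma deriv_v_at: "r > 0 \<Longrightarrow> (v has_real_derivative v' r) (at r)"
  using deriv_v[of r] at_within_interior[of r "{0..}"] by simp

lemma cont_v: "continuous_on {0..} v"
  using DERIV_continuous_on[of "{0..}" v v'] deriv_v by auto

text \<open>Divergence form of the equation: the integrating factor \<open>r ^ n\<close> absorbs the
  singular first-order term.\<close>

lemma deriv_flux: "r > 0 \<Longrightarrow> ((\<lambda>r. r ^ n * v' r) has_real_derivative - (r ^ n * g r)) (at r)"
  using n_pos by (intro DERIV_cong[OF DERIV_mult[OF DERIV_pow deriv_v']])
    (auto simp: gr0_conv_Suc field_simps)

text \<open>Continuity of \<open>v'\<close> at \<open>0\<close> is not part of the locale, so the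
  flux \<open>r ^ n * v' r\<close> has to be controlled near \<open>0\<close> by other means. As
  \<open>v\<close> has derivative zero at \<open>0\<close>, its difference quotients there are
  small, and the mean value theorem turns one of them into a value \<open>v' z\<close>. From
  \<open>z\<close> to \<open>r\<close> the flux changes by at most
  \<open>r * (r ^ n * M)\<close>.\<close>

lemma abs_v'_le:
  assumes M: "\<And>s. 0 \<le> s \<Longrightarrow> s \<le> r \<Longrightarrow> \<bar>g s\<bar> \<le> M" and r: "r > 0"
  shows "\<bar>v' r\<bar> \<le> M * r"
proof -
  have "M \<ge> 0" using M[of r] r by simp
  have "\<bar>r ^ n * v' r\<bar> \<le> M * r * r ^ n + e" if e: "e > 0" for e
  proof -
    \<comment> \<open>Scaled so that the flux at \<open>z\<close>, which is at most
      \<open>r ^ n * e'\<close> in absolute value, contributes at most \<open>e\<close>.\<close>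
    define e' where "e' = e / r ^ n"
    have e': "e' > 0" using e r by (simp add: e'_def)
    have "((\<lambda>h. (v h - v 0) / h) \<longlongrightarrow> 0) (at 0 within {0..})"
      using deriv_v[of 0] v'_0 by (simp add: has_field_derivative_iff)
    then have "eventually (\<lambda>h. \<bar>(v h - v 0) / h\<bar> < e') (at 0 within {0..})"
      using e' by (simp add: tendsto_iff)
    then obtain d where d: "d > 0" and
      D: "\<And>h. h \<ge> 0 \<Longrightarrow> h \<noteq> 0 \<Longrightarrow> dist h 0 < d \<Longrightarrow> \<bar>(v h - v 0) / h\<bar> < e'"
      by (auto simp: eventually_at)
    define h where "h = min (d / 2) r"
    have h: "h > 0" "h \<le> r" "h < d" using d r by (auto simp: h_def)
    have "\<exists>l z. 0 < z \<and> z < h \<and> DERIV v z :> l \<and> v h - v 0 = (h - 0) * l"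
      by (rule MVT)
         (use h in \<open>auto intro: continuous_on_subset[OF cont_v] deriv_v_at simp: real_differentiable_def\<close>)
    then obtain l z where z: "0 < z" "z < h" "DERIV v z :> l" "v h - v 0 = h * l" by auto
    with deriv_v_at[of z] have "l = v' z" using DERIV_unique by blast
    with D[of h] h z have v'z: "\<bar>v' z\<bar> \<le> e'" by (auto simp: field_simps)
    have flux_diff: "\<exists>D. ((\<lambda>r. r ^ n * v' r) has_real_derivative D) (at y)" if "z \<le> y" for y
      using deriv_flux[of y] that z by auto
    have "\<exists>l y. z < y \<and> y < r \<and> DERIV (\<lambda>r. r ^ n * v' r) y :> l \<and> r ^ n * v' r - z ^ n * v' z = (r - z) * l"
      by (rule MVT)
         (use z h flux_diff in \<open>auto intro!: DERIV_atLeastAtMost_imp_continuous_on simp: real_differentiable_def\<close>)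
    then obtain l y where y: "z < y" "y < r" "DERIV (\<lambda>r. r ^ n * v' r) y :> l"
      "r ^ n * v' r - z ^ n * v' z = (r - z) * l" by auto
    with deriv_flux[of y] z have "l = - (y ^ n * g y)"
      using DERIV_unique by (metis order_less_trans)
    then have "\<bar>l\<bar> = y ^ n * \<bar>g y\<bar>" using y z by (simp add: abs_mult)
    also have "\<dots> \<le> r ^ n * M"
      using y z \<open>M \<ge> 0\<close> by (intro mult_mono power_mono M) auto
    finally have "(r - z) * \<bar>l\<bar> \<le> r * (r ^ n * M)"
      using y z r by (intro mult_mono) auto
    moreover have "\<bar>z ^ n * v' z\<bar> \<le> r ^ n * e'"
      unfolding abs_mult using z h v'z by (intro mult_mono) (auto intro!: power_mono simp: power_abs)
    moreover have "\<bar>(r - z) * l\<bar> = (r - z) * \<bar>l\<bar>" using y by (simp add: abs_mult)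
    moreover have "r ^ n * e' = e" using r by (simp add: e'_def)
    ultimately show ?thesis using y(4) by (simp add: algebra_simps)
  qed
  then have "\<bar>r ^ n * v' r\<bar> \<le> M * r * r ^ n"
    by (rule field_le_epsilon)
  then have "\<bar>v' r\<bar> * r ^ n \<le> (M * r) * r ^ n"
    using r by (simp add: abs_mult mult.commute)
  then show ?thesis using r by simp
qed

text \<open>Only the point \<open>0\<close> needs an argument: there \<open>g\<close> is bounded
  nearby, and \<open>abs_v'_le\<close> gives linear decay of \<open>v'\<close>.\<close>

lemma cont_v': "continuous_on {0..} v'"
proof -
  have "continuous (at r within {0..}) v'" if r: "r \<ge> 0" for r
  proof (cases "r = 0")
    case False
    with r have "isCont v' r" using deriv_v'[of r] DERIV_isCont by auto
    then show ?thesis by (rule continuous_at_imp_continuous_at_within)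
  next
    case True
    have "bounded (g ` {0..1})"
      by (intro compact_imp_bounded compact_continuous_image continuous_on_subset[OF cont_g]) auto
    then obtain M where M: "\<And>s. 0 \<le> s \<Longrightarrow> s \<le> 1 \<Longrightarrow> \<bar>g s\<bar> \<le> M"
      unfolding bounded_iff by fastforce
    have "(v' \<longlongrightarrow> 0) (at 0 within {0..})"
    proof (rule Lim_null_comparison)
      show "\<forall>\<^sub>F r in at 0 within {0..}. norm (v' r) \<le> M * r"
        using abs_v'_le[of _ M] M
        by (auto simp: eventually_at dist_real_def intro!: exI[of _ 1])
      show "((\<lambda>r. M * r) \<longlongrightarrow> 0) (at 0 within {0..})"
        by (auto intro!: tendsto_eq_intros)
    qed
    then show ?thesis using True v'_0 by (simp add: continuous_within)
  qed
  then show ?thesis by (simp add: continuous_on_eq_continuous_within)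
qed

section \<open>A compactly supported test function with negative energy\<close>

text \<open>The natural test function \<open>v\<close>, extended by zero beyond \<open>R\<close>, is only Lipschitz. It is replaced
  by \<open>h(v)\<close> with \<open>h s = s\<^sup>2 / (s + e)\<close>, and \<open>G\<close> below is the primitive of \<open>(h')\<^sup>2\<close>: multiplying the
  equation by \<open>G(v)\<close> turns the Dirichlet energy of \<open>h(v)\<close> into the integral of \<open>g G(v)\<close>.\<close>

lemma exists_destabilizing_function:
  fixes V :: "real \<Rightarrow> real"
  assumes dim: "DIM('a::euclidean_space) = Suc n"
    and R: "R > 0" and vR: "v R = 0"
    and pos: "\<And>r. 0 \<le> r \<Longrightarrow> r < R \<Longrightarrow> v r > 0"
    and less: "\<And>r. 0 \<le> r \<Longrightarrow> r < R \<Longrightarrow> g r < V r * v r"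
    and cont_V: "continuous_on {0..} V"
  obtains \<phi> :: "'a::euclidean_space \<Rightarrow> real" and \<psi> where
    "\<And>x. GDERIV \<phi> x :> \<psi> x" "continuous_on UNIV \<psi>" "compact (closure {x. \<phi> x \<noteq> 0})"
    "(\<integral>x. ((norm (\<psi> x))\<^sup>2 - V (norm x) * (\<phi> x)\<^sup>2) \<partial>lborel) < 0"
proof -
  have nonneg: "v r \<ge> 0" if "0 \<le> r" "r \<le> R" for r
    using pos[of r] vR that by (cases "r = R") auto
  have cv: "continuous_on {0..R} v" and cv': "continuous_on {0..R} v'"
    and cg: "continuous_on {0..R} g" and cV: "continuous_on {0..R} V"
    by (auto intro: continuous_on_subset[OF cont_v] continuous_on_subset[OF cont_v']
        continuous_on_subset[OF cont_g] continuous_on_subset[OF cont_V])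
  \<comment> \<open>Up to the area factor of the sphere, \<open>- I\<close> is the quadratic form at
    the unmodified \<open>v\<close>, because the Dirichlet energy of \<open>v\<close> is the
    integral of \<open>g\<close> times \<open>v\<close>. It is the negative amount that must survive
    the regularization.\<close>
  define I where "I = integral {0..R} (\<lambda>r. r ^ n * (V r * v r - g r) * v r)"
  have cI: "continuous_on {0..R} (\<lambda>r. r ^ n * (V r * v r - g r) * v r)"
    by (intro continuous_intros cv cg cV)
  have I_nonneg: "r ^ n * (V r * v r - g r) * v r \<ge> 0" if "r \<in> {0..R}" for r
    using that less[of r] nonneg[of r] vR by (cases "r = R") auto
  have "I > 0"
  proof -
    have "I \<noteq> 0"
    proof
      assume "I = 0"
      then have "\<forall>r\<in>{0..R}. r ^ n * (V r * v r - g r) * v r = 0"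
        unfolding I_def using integral_eq_0_iff[OF cI R I_nonneg] by simp
      then have "(R/2) ^ n * (V (R/2) * v (R/2) - g (R/2)) * v (R/2) = 0"
        using R by (auto dest: bspec[of _ _ "R/2"])
      then show False
        using less[of "R/2"] pos[of "R/2"] R by auto
    qed
    moreover have "I \<ge> 0"
      unfolding I_def by (intro integral_nonneg integrable_continuous_interval cI I_nonneg)
    ultimately show ?thesis by simp
  qed
  \<comment> \<open>Passing from \<open>v\<close> to \<open>h(v)\<close> will cost at most
    \<open>e * C\<close>. The choice of \<open>e\<close> below keeps this under \<open>I\<close>,
    and the summand 1 in its denominator covers \<open>C = 0\<close>.\<close>
  define C where "C = integral {0..R} (\<lambda>r. r ^ n * (2 * \<bar>g r\<bar> + 2 * \<bar>V r\<bar> * v r))"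
  have cC: "continuous_on {0..R} (\<lambda>r. r ^ n * (2 * \<bar>g r\<bar> + 2 * \<bar>V r\<bar> * v r))"
    by (intro continuous_intros cv cg cV)
  have "C \<ge> 0"
    unfolding C_def by (intro integral_nonneg integrable_continuous_interval cC) (auto simp: nonneg)
  define e where "e = I / (C + 1)"
  have e: "e > 0" "e * C < I"
    using \<open>I > 0\<close> \<open>C \<ge> 0\<close> by (auto simp: e_def field_simps)
  \<comment> \<open>\<open>h\<close> vanishes to second order at \<open>0\<close>, so
    \<open>h(v)\<close> meets the zero function at \<open>R\<close> with value and slope zero,
    whatever \<open>v' R\<close> is. It also stays within \<open>e\<close> of the identity.\<close>
  define h where "h = (\<lambda>s::real. s\<^sup>2 / (s + e))"
  define h' where "h' = (\<lambda>s::real. 1 - e\<^sup>2 / (s + e)\<^sup>2)"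
  \<comment> \<open>Obtained by expanding the square of \<open>h'\<close> and integrating termwise;
    the constant \<open>- 5/3 * e\<close> normalizes \<open>G 0 = 0\<close>.\<close>
  define G where "G = (\<lambda>s::real. s - 5/3 * e + 2 * e\<^sup>2 / (s + e) - e ^ 4 / (3 * (s + e) ^ 3))"
  have h_deriv: "(h has_real_derivative h' s) (at s within S)" if "s \<ge> 0" for s S
    unfolding h_def h'_def using that e
    by (auto intro!: derivative_eq_intros simp: power2_eq_square divide_simps) (auto simp: algebra_simps)
  have G_deriv: "(G has_real_derivative (h' s)\<^sup>2) (at s)" if "s \<ge> 0" for s
  proof -
    have *: "s + e \<noteq> 0" using that e by simp
    have "(G has_real_derivative
        1 - 2 * e\<^sup>2 / (s + e) ^ 2 + e ^ 4 * (3 * (3 * (s + e) ^ 2)) / (3 * (s + e) ^ 3)\<^sup>2) (at s)"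
      unfolding G_def using *
      by (auto intro!: derivative_eq_intros simp: power2_eq_square)
    moreover have "1 - 2 * e\<^sup>2 / (s + e) ^ 2 + e ^ 4 * (3 * (3 * (s + e) ^ 2)) / (3 * (s + e) ^ 3)\<^sup>2 = (h' s)\<^sup>2"
    proof -
      have "e ^ 4 * (3 * (3 * (s + e) ^ 2)) / (3 * (s + e) ^ 3)\<^sup>2 = e ^ 4 / (s + e) ^ 4"
      proof -
        have "e ^ 4 * (3 * (3 * t ^ 2)) / (3 * t ^ 3)\<^sup>2 = e ^ 4 / t ^ 4" if "t \<noteq> 0" for t :: real
          using that by (simp add: field_simps eval_nat_numeral)
        then show ?thesis using * by blast
      qed
      also have "\<dots> = (e\<^sup>2 / (s + e)\<^sup>2)\<^sup>2"
        by (simp add: power_divide)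
      finally show ?thesis
        unfolding h'_def by (simp add: power2_diff)
    qed
    ultimately show ?thesis by simp
  qed
  have h0 [simp]: "h 0 = 0" "h' 0 = 0" and G0: "G 0 = 0"
    using e by (auto simp: h_def h'_def G_def field_simps eval_nat_numeral)
  have h_bounds: "0 \<le> h s" "h s \<le> s" "s - h s \<le> e" if "s \<ge> 0" for s
    using that e by (auto simp: h_def field_simps power2_eq_square)
  have G_bounds: "\<bar>G s - s\<bar> \<le> 2 * e" if "s \<ge> 0" for s
  proof -
    have "0 \<le> e\<^sup>2 / (s + e)" "e\<^sup>2 / (s + e) \<le> e"
      using that e by (auto simp: field_simps power2_eq_square)
    moreover have "0 \<le> e ^ 4 / (3 * (s + e) ^ 3)"
      using that e by simp
    moreover have "e ^ 4 / (3 * (s + e) ^ 3) \<le> e / 3"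
    proof -
      have "e ^ 3 \<le> (s + e) ^ 3" using that e by (intro power_mono) auto
      then have "e * e ^ 3 \<le> e * (s + e) ^ 3" using e by (intro mult_left_mono) auto
      then have "e * e ^ 3 / (3 * (s + e) ^ 3) \<le> e * (s + e) ^ 3 / (3 * (s + e) ^ 3)"
        using that e by (intro divide_right_mono) auto
      moreover have "e * e ^ 3 = e ^ 4" by (simp add: eval_nat_numeral)
      ultimately show ?thesis using that e by simp
    qed
    ultimately show ?thesis unfolding G_def by linarith
  qed
  have ch: "continuous_on {0..} h" and ch': "continuous_on {0..} h'" and cG: "continuous_on {0..} G"
    unfolding h_def h'_def G_def using e by (auto intro!: continuous_intros)
  have chv: "continuous_on {0..R} (\<lambda>r. h (v r))" and ch'v: "continuous_on {0..R} (\<lambda>r. h' (v r))"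
    and cGv: "continuous_on {0..R} (\<lambda>r. G (v r))"
    by (auto intro!: continuous_on_compose2[OF ch cv] continuous_on_compose2[OF ch' cv]
        continuous_on_compose2[OF cG cv] simp: nonneg)
  define \<Phi> where "\<Phi> = (\<lambda>r. if r \<in> {0..R} then h (v r) else 0)"
  define \<Phi>' where "\<Phi>' = (\<lambda>r. if r \<in> {0..R} then h' (v r) * v' r else 0)"
  have split: "{0..} = {0..R} \<union> {R..}" using R by auto
  have \<Phi>_deriv: "(\<Phi> has_real_derivative \<Phi>' r) (at r within {0..})" if "r \<ge> 0" for r
  proof -
    have "((\<lambda>r. if r \<in> {0..R} then h (v r) else 0) has_vector_derivative
        (if r \<in> {0..R} then h' (v r) * v' r else 0)) (at r within {0..})"
    proof (rule has_vector_derivative_If_within_closures[where T = "{R..}"])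
      show "{0..} = {0..R} \<union> {R..}" by (rule split)
      show "r \<in> {0..R} \<union> {R..}" using that by auto
      show "((\<lambda>r. h (v r)) has_vector_derivative h' (v r) * v' r)
          (at r within {0..R} \<union> closure {0..R} \<inter> closure {R..})"
        if "r \<in> {0..R} \<union> closure {0..R} \<inter> closure {R..}"
      proof -
        have r: "r \<ge> 0" "r \<le> R" using that by auto
        have "{0..R} \<union> closure {0..R} \<inter> closure {R..} = {0..R}" using R by auto
        moreover have "((\<lambda>r. h (v r)) has_real_derivative h' (v r) * v' r) (at r within {0..R})"
          using DERIV_image_chain[OF h_deriv[OF nonneg[OF r]] DERIV_subset[OF deriv_v[OF r(1)]], of "{0..R}"]
          by (auto simp: o_def)
        ultimately show ?thesis
          by (simp add: has_real_derivative_iff_has_vector_derivative)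
      qed
    qed (use R vR in \<open>auto\<close>)
    then show ?thesis
      unfolding \<Phi>_def \<Phi>'_def has_real_derivative_iff_has_vector_derivative .
  qed
  have \<Phi>'_cont: "continuous_on {0..} \<Phi>'"
    unfolding split \<Phi>'_def
    by (intro continuous_on_cases) (use vR in \<open>auto intro!: continuous_intros ch'v cv'\<close>)
  have \<Phi>'0: "\<Phi>' 0 = 0" using v'_0 R by (simp add: \<Phi>'_def)
  define H where "H = (\<lambda>r. (\<Phi>' r)\<^sup>2 - V r * (\<Phi> r)\<^sup>2)"
  have cH: "continuous_on {0..R} H"
  proof -
    have "continuous_on {0..} \<Phi>"
      by (rule DERIV_continuous_on) (auto intro: \<Phi>_deriv)
    then show ?thesis
      unfolding H_def
      by (intro continuous_intros cV continuous_on_subset[OF \<Phi>'_cont])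
         (auto intro: continuous_on_subset)
  qed
  \<comment> \<open>The integrand is the derivative of the flux times \<open>G(v)\<close>. Both
    boundary terms vanish, at \<open>0\<close> because \<open>v' 0 = 0\<close> and at
    \<open>R\<close> because \<open>G (v R) = G 0 = 0\<close>.\<close>
  have energy: "((\<lambda>r. r ^ n * (h' (v r) * v' r)\<^sup>2 - r ^ n * g r * G (v r)) has_integral 0) {0..R}"
  proof -
    have "((\<lambda>r. r ^ n * (h' (v r) * v' r)\<^sup>2 - r ^ n * g r * G (v r)) has_integral
        (R ^ n * v' R * G (v R) - 0 ^ n * v' 0 * G (v 0))) {0..R}"
    proof (rule fundamental_theorem_of_calculus_interior)
      show "continuous_on {0..R} (\<lambda>r. r ^ n * v' r * G (v r))"
        by (intro continuous_intros cv' cGv)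
      fix r assume "r \<in> {0<..<R}"
      then have r: "r > 0" "r < R" by auto
      have "((\<lambda>r. G (v r)) has_real_derivative (h' (v r))\<^sup>2 * v' r) (at r)"
        by (rule DERIV_chain2[OF G_deriv deriv_v_at]) (use r nonneg in auto)
      from DERIV_mult[OF deriv_flux[OF r(1)] this]
      show "((\<lambda>r. r ^ n * v' r * G (v r)) has_vector_derivative
          r ^ n * (h' (v r) * v' r)\<^sup>2 - r ^ n * g r * G (v r)) (at r)"
        unfolding has_real_derivative_iff_has_vector_derivative[symmetric]
        by (rule DERIV_cong) (simp add: algebra_simps power2_eq_square)
    qed (use R in simp)
    then show ?thesis by (simp add: vR G0 v'_0)
  qed
  have "integral {0..R} (\<lambda>r. r ^ n * H r) < 0"
  proof -
    have "integral {0..R} (\<lambda>r. r ^ n * H r) =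
      integral {0..R} (\<lambda>r. r ^ n * (h' (v r) * v' r)\<^sup>2 - r ^ n * V r * (h (v r))\<^sup>2)"
      by (rule Henstock_Kurzweil_Integration.integral_cong)
         (simp add: H_def \<Phi>_def \<Phi>'_def algebra_simps)
    \<comment> \<open>The term \<open>r ^ n * g r * G (v r)\<close> is subtracted and added, so that
      the first bracket integrates to zero by \<open>energy\<close> and no derivative of
      \<open>v\<close> remains.\<close>
    also have "\<dots> = integral {0..R} (\<lambda>r. (r ^ n * (h' (v r) * v' r)\<^sup>2 - r ^ n * g r * G (v r)) +
        (r ^ n * (g r * G (v r) - V r * (h (v r))\<^sup>2)))"
      by (simp add: algebra_simps)
    also have "\<dots> = integral {0..R} (\<lambda>r. r ^ n * (h' (v r) * v' r)\<^sup>2 - r ^ n * g r * G (v r)) +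
        integral {0..R} (\<lambda>r. r ^ n * (g r * G (v r) - V r * (h (v r))\<^sup>2))"
      by (intro integral_add integrable_continuous_interval continuous_intros cv' ch'v cg cGv cV chv)
    also have "integral {0..R} (\<lambda>r. r ^ n * (h' (v r) * v' r)\<^sup>2 - r ^ n * g r * G (v r)) = 0"
      using energy by (rule integral_unique)
    \<comment> \<open>Pointwise, replacing \<open>G(v)\<close> by \<open>v\<close> costs at most
      \<open>2 * e * \<bar>g\<bar>\<close>, and replacing the square of \<open>h(v)\<close> by that
      of \<open>v\<close> costs at most \<open>2 * e * \<bar>V\<bar> * v\<close>.\<close>
    also have "0 + integral {0..R} (\<lambda>r. r ^ n * (g r * G (v r) - V r * (h (v r))\<^sup>2)) \<le>
       integral {0..R} (\<lambda>r. e * (r ^ n * (2 * \<bar>g r\<bar> + 2 * \<bar>V r\<bar> * v r)) - r ^ n * (V r * v r - g r) * v r)"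
      unfolding add_0
    proof (rule integral_le)
      fix r assume "r \<in> {0..R}"
      then have r: "0 \<le> r" "r \<le> R" by auto
      note s = nonneg[OF r]
      have 1: "g r * (G (v r) - v r) \<le> \<bar>g r\<bar> * (2 * e)"
        using mult_left_mono[OF G_bounds[OF s], of "\<bar>g r\<bar>"] abs_ge_self[of "g r * (G (v r) - v r)"]
        by (simp add: abs_mult)
      have "(v r)\<^sup>2 - (h (v r))\<^sup>2 = (v r - h (v r)) * (v r + h (v r))"
        by (simp add: power2_eq_square algebra_simps)
      also have "\<dots> \<le> e * (2 * v r)"
        using h_bounds[OF s] s by (intro mult_mono) auto
      finally have 2: "(v r)\<^sup>2 - (h (v r))\<^sup>2 \<le> e * (2 * v r)" .
      have 3: "(v r)\<^sup>2 - (h (v r))\<^sup>2 \<ge> 0"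
        using h_bounds[OF s] by (simp add: power_mono)
      have "V r * ((v r)\<^sup>2 - (h (v r))\<^sup>2) \<le> \<bar>V r\<bar> * ((v r)\<^sup>2 - (h (v r))\<^sup>2)"
        using 3 by (intro mult_right_mono) auto
      also have "\<dots> \<le> \<bar>V r\<bar> * (e * (2 * v r))"
        by (intro mult_left_mono 2) auto
      finally have "g r * G (v r) - V r * (h (v r))\<^sup>2 \<le>
          e * (2 * \<bar>g r\<bar> + 2 * \<bar>V r\<bar> * v r) - (V r * v r - g r) * v r"
        using 1 by (simp add: algebra_simps power2_eq_square)
      from mult_left_mono[OF this, of "r ^ n"] r
      show "r ^ n * (g r * G (v r) - V r * (h (v r))\<^sup>2) \<le>
          e * (r ^ n * (2 * \<bar>g r\<bar> + 2 * \<bar>V r\<bar> * v r)) - r ^ n * (V r * v r - g r) * v r"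
        by (simp add: algebra_simps)
    qed (intro integrable_continuous_interval continuous_intros cv cg cV cGv chv)+
    also have "\<dots> = integral {0..R} (\<lambda>r. e * (r ^ n * (2 * \<bar>g r\<bar> + 2 * \<bar>V r\<bar> * v r))) - I"
      unfolding I_def
      by (intro integral_diff integrable_continuous_interval continuous_intros cv cg cV)
    also have "\<dots> = e * C - I"
      by (simp add: C_def)
    also have "\<dots> < 0" using e by simp
    finally show ?thesis .
  qed
  moreover have "real DIM('a) * unit_ball_vol DIM('a) > 0"
    by (intro mult_pos_pos unit_ball_vol_pos) auto
  moreover have "(\<integral>x. H (norm (x::'a)) \<partial>lborel) =
      real DIM('a) * unit_ball_vol DIM('a) * integral {0..R} (\<lambda>r. r ^ (DIM('a) - 1) * H r)"
    by (rule integral_radial[OF cH]) (simp add: H_def \<Phi>_def \<Phi>'_def)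
  ultimately have neg: "(\<integral>x. H (norm (x::'a)) \<partial>lborel) < 0"
    by (simp add: dim mult_pos_neg)
  show ?thesis
  proof (rule that)
    show "GDERIV (\<lambda>x::'a. \<Phi> (norm x)) x :> \<Phi>' (norm x) *\<^sub>R sgn x" for x
      by (rule GDERIV_radial[OF \<Phi>_deriv \<Phi>'0])
    show "continuous_on UNIV (\<lambda>x::'a. \<Phi>' (norm x) *\<^sub>R sgn x)"
      by (rule continuous_on_radial_gradient[OF \<Phi>'_cont \<Phi>'0])
    have "{x::'a. \<Phi> (norm x) \<noteq> 0} \<subseteq> cball 0 R"
      by (auto simp: \<Phi>_def split: if_splits)
    then show "compact (closure {x::'a. \<Phi> (norm x) \<noteq> 0})"
      using bounded_subset[OF bounded_cball] by (simp add: compact_closure)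
    have "(norm (\<Phi>' (norm x) *\<^sub>R sgn x))\<^sup>2 = (\<Phi>' (norm x))\<^sup>2" for x :: 'a
      using \<Phi>'0 by (cases "x = 0") (auto simp: norm_sgn)
    then show "(\<integral>x. ((norm (\<Phi>' (norm x) *\<^sub>R sgn x))\<^sup>2 - V (norm x) * (\<Phi> (norm (x::'a)))\<^sup>2) \<partial>lborel) < 0"
      using neg by (simp add: H_def)
  qed
qed

section \<open>Bounds by the central value\<close>

text \<open>A nonnegative source makes the flux nonincreasing from its value zero at the origin,
  hence \<open>v'\<close> is nonpositive.\<close>

lemma v_le_v_0:
  assumes g: "\<And>r. r \<ge> 0 \<Longrightarrow> g r \<ge> 0" and r: "r \<ge> 0"
  shows "v r \<le> v 0"
proof -
  have v'_nonpos: "v' s \<le> 0" if s: "s > 0" for s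
  proof -
    have "s ^ n * v' s \<le> 0 ^ n * v' 0"
    proof (rule DERIV_nonpos_imp_decreasing_open[where f = "\<lambda>r. r ^ n * v' r"])
      show "continuous_on {0..s} (\<lambda>r. r ^ n * v' r)"
        by (intro continuous_intros continuous_on_subset[OF cont_v']) auto
      show "\<exists>y. ((\<lambda>r. r ^ n * v' r) has_real_derivative y) (at x) \<and> y \<le> 0" if "0 < x" for x
        using deriv_flux[OF that] g[of x] that by (intro exI[of _ "- (x ^ n * g x)"]) auto
    qed (use s in auto)
    then show ?thesis using s v'_0 zero_less_power[OF s, of n] by (auto simp: mult_le_0_iff)
  qed
  show ?thesis
    by (rule DERIV_nonpos_imp_decreasing_open[where f = v])
       (use r v'_nonpos deriv_v_at in \<open>auto intro: continuous_on_subset[OF cont_v]\<close>)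
qed

lemma gronwall:
  assumes g: "\<And>s. 0 \<le> s \<Longrightarrow> s \<le> r \<Longrightarrow> \<bar>g s\<bar> \<le> L * \<bar>v s\<bar>" and L: "L \<ge> 0" and r: "r \<ge> 0"
  shows "(v r)\<^sup>2 \<le> (v 0)\<^sup>2 * exp ((1 + L) * r)"
proof -
  define E where "E = (\<lambda>s. ((v s)\<^sup>2 + (v' s)\<^sup>2) * exp (- ((1 + L) * s)))"
  have "E r \<le> E 0"
  proof (rule DERIV_nonpos_imp_decreasing_open[where f = E])
    show "continuous_on {0..r} E"
      unfolding E_def
      by (intro continuous_intros continuous_on_subset[OF cont_v] continuous_on_subset[OF cont_v']) auto
    fix s assume s: "0 < s" "s < r"
    define D where "D = (2 * v s * v' s + 2 * v' s * (- (real n / s * v' s) - g s)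
      - (1 + L) * ((v s)\<^sup>2 + (v' s)\<^sup>2)) * exp (- ((1 + L) * s))"
    have "(E has_real_derivative D) (at s)"
      unfolding E_def D_def using s
      by (auto intro!: derivative_eq_intros deriv_v_at deriv_v' simp: algebra_simps)
    moreover have "D \<le> 0"
    proof -
      have "2 * v s * v' s - 2 * v' s * g s \<le> 2 * \<bar>v s\<bar> * \<bar>v' s\<bar> + 2 * \<bar>v' s\<bar> * \<bar>g s\<bar>"
        using abs_ge_self[of "v s * v' s"] abs_ge_self[of "- v' s * g s"] by (simp add: abs_mult)
      also have "\<dots> \<le> 2 * \<bar>v s\<bar> * \<bar>v' s\<bar> + 2 * \<bar>v' s\<bar> * (L * \<bar>v s\<bar>)"
        using g[of s] s by (intro add_left_mono mult_left_mono) auto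
      also have "\<dots> = (1 + L) * (2 * \<bar>v s\<bar> * \<bar>v' s\<bar>)"
        by (simp add: algebra_simps)
      also have "\<dots> \<le> (1 + L) * ((v s)\<^sup>2 + (v' s)\<^sup>2)"
        using L sum_squares_bound[of "\<bar>v s\<bar>" "\<bar>v' s\<bar>"] by (intro mult_left_mono) auto
      finally have "2 * v s * v' s - 2 * v' s * g s \<le> (1 + L) * ((v s)\<^sup>2 + (v' s)\<^sup>2)" .
      moreover have "2 * v' s * (- (real n / s * v' s) - g s) = - (2 * (real n / s) * (v' s)\<^sup>2) - 2 * v' s * g s"
        by (simp add: power2_eq_square algebra_simps)
      moreover have "2 * (real n / s) * (v' s)\<^sup>2 \<ge> 0"
        using s by simp
      ultimately show ?thesis
        unfolding D_def by (intro mult_nonpos_nonneg) auto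
    qed
    ultimately show "\<exists>D. (E has_real_derivative D) (at s) \<and> D \<le> 0" by blast
  qed (use r in auto)
  then have "((v r)\<^sup>2 + (v' r)\<^sup>2) * exp (- ((1 + L) * r)) \<le> (v 0)\<^sup>2"
    by (simp add: E_def v'_0)
  from mult_right_mono[OF this, of "exp ((1 + L) * r)"]
  have "(v r)\<^sup>2 + (v' r)\<^sup>2 \<le> (v 0)\<^sup>2 * exp ((1 + L) * r)"
    by (simp add: mult.assoc flip: exp_add)
  then show ?thesis
    using zero_le_power2[of "v' r"] by linarith
qed

end

text \<open>This is why the locale has a free source \<open>g\<close>: the difference of two
  solutions of the nonlinear equation solves the linear one with source
  \<open>f(v) - f(w)\<close>.\<close>

lemma radial_poisson_diff:
  assumes "radial_poisson n v v' g" "radial_poisson n w w' k"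
  shows "radial_poisson n (\<lambda>r. v r - w r) (\<lambda>r. v' r - w' r) (\<lambda>r. g r - k r)"
proof -
  interpret v: radial_poisson n v v' g by fact
  interpret w: radial_poisson n w w' k by fact
  show ?thesis
    by unfold_locales
       (auto intro!: derivative_eq_intros v.deriv_v w.deriv_v v.deriv_v' w.deriv_v' continuous_intros
         v.cont_g w.cont_g v.n_pos simp: v.v'_0 w.v'_0 algebra_simps)
qed

section \<open>First zeros and integrability of the quadratic form\<close>

lemma first_zero_obtain:
  fixes p :: "real \<Rightarrow> real"
  assumes cont: "continuous_on {0..} p" and p0: "p 0 > 0" and r: "r \<ge> 0" "p r \<le> 0"
  obtains R where "R > 0" "p R = 0" "\<And>s. 0 \<le> s \<Longrightarrow> s < R \<Longrightarrow> p s > 0"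
proof -
  have "closed ({0..r} \<inter> p -` {..0})"
    by (intro continuous_closed_preimage continuous_on_subset[OF cont]) auto
  then have "compact ({0..r} \<inter> p -` {..0})"
    by (metis compact_Icc compact_Int_closed inf.idem inf_assoc)
  moreover have "{0..r} \<inter> p -` {..0} \<noteq> {}" using r by auto
  ultimately obtain R where R: "0 \<le> R" "R \<le> r" "p R \<le> 0"
    and min: "\<And>s. 0 \<le> s \<Longrightarrow> s \<le> r \<Longrightarrow> p s \<le> 0 \<Longrightarrow> R \<le> s"
    using compact_attains_inf[of "{0..r} \<inter> p -` {..0}"] by fastforce
  have pos: "p s > 0" if "0 \<le> s" "s < R" for s
    using min[of s] that R by force
  obtain x where x: "0 \<le> x" "x \<le> R" "p x = 0"
    using IVT2'[of p R 0 0] R p0 continuous_on_subset[OF cont, of "{0..R}"] by force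
  with pos[of x] have "x = R" by force
  with x p0 R have "R > 0" "p R = 0"
    by (cases "R = 0", auto)
  then show ?thesis using pos by (rule that)
qed

text \<open>The complement of the support is open, so the gradient vanishes there together with
  \<phi>, and the integrand is continuous with compact support. This justifies comparing and passing
  to the limit in the stability integrals.\<close>

lemma test_function_integrable:
  fixes \<phi> :: "'a::euclidean_space \<Rightarrow> real"
  assumes \<phi>: "\<And>x. GDERIV \<phi> x :> \<psi> x" and \<psi>: "continuous_on UNIV \<psi>"
    and comp: "compact (closure {x. \<phi> x \<noteq> 0})" and W: "continuous_on UNIV W"
  shows "continuous_on UNIV (\<lambda>x. (norm (\<psi> x))\<^sup>2 - W x * (\<phi> x)\<^sup>2)" (is "continuous_on _ ?q")
    and "integrable lborel (\<lambda>x. (norm (\<psi> x))\<^sup>2 - W x * (\<phi> x)\<^sup>2)"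
proof -
  define K where "K = closure {x. \<phi> x \<noteq> 0}"
  have "continuous_on UNIV \<phi>"
    using \<phi> unfolding gderiv_def by (meson has_derivative_continuous continuous_at_imp_continuous_on)
  then show cont: "continuous_on UNIV ?q"
    by (intro continuous_intros \<psi> W)
  have zero: "\<phi> x = 0 \<and> \<psi> x = 0" if x: "x \<notin> K" for x
  proof -
    have open_compl: "open (- K)" by (simp add: K_def open_Compl)
    have \<phi>0: "\<phi> y = 0" if "y \<in> - K" for y
      using that closure_subset[of "{x. \<phi> x \<noteq> 0}"] by (auto simp: K_def)
    have "(\<phi> has_derivative (\<lambda>h. 0)) (at x)"
      by (rule has_derivative_transform_within_open[of "\<lambda>_. 0" _ _ _ "- K"])
         (use open_compl x \<phi>0 in auto)
    moreover have "(\<phi> has_derivative (\<lambda>h. h \<bullet> \<psi> x)) (at x)"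
      using \<phi> by (simp add: gderiv_def)
    ultimately have "(\<lambda>h. h \<bullet> \<psi> x) = (\<lambda>h. 0)"
      using has_derivative_unique by blast
    from fun_cong[OF this, of "\<psi> x"] have "\<psi> x \<bullet> \<psi> x = 0" .
    with x \<phi>0 show ?thesis by auto
  qed
  have "integrable lborel (\<lambda>x. indicator K x *\<^sub>R ?q x)"
    using comp by (intro borel_integrable_compact continuous_on_subset[OF cont]) (auto simp: K_def)
  moreover have "(\<lambda>x. indicator K x *\<^sub>R ?q x) = ?q"
    by (auto simp: fun_eq_iff indicator_def zero)
  ultimately show "integrable lborel ?q" by simp
qed

section \<open>Convexity properties of the nonlinearity\<close>

context
  fixes f :: "real \<Rightarrow> real"
  assumes adm: "admissible_nonlinearity f"
begin

lemma admissible_DERIV: "(f has_real_derivative deriv f x) (at x)"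
  using adm unfolding admissible_nonlinearity_def differentiable_on_def
  by (metis DERIV_deriv_iff_real_differentiable UNIV_I)

lemma admissible_continuous: "continuous_on UNIV f"
  using admissible_DERIV by (meson DERIV_isCont continuous_at_imp_continuous_on)

lemma admissible_deriv_continuous: "continuous_on UNIV (deriv f)"
  using adm by (simp add: admissible_nonlinearity_def)

lemma admissible_zero: "f 0 = 0"
proof -
  have "f (- 0) = - f 0" using adm unfolding admissible_nonlinearity_def by blast
  then show ?thesis by simp
qed

lemma admissible_pos: "x > 0 \<Longrightarrow> f x > 0"
  using adm by (simp add: admissible_nonlinearity_def)

text \<open>The second derivative is available only off \<open>0\<close>; continuity of
  \<open>deriv f\<close> brings in the endpoint \<open>a = 0\<close>.\<close>

lemma admissible_deriv_strict_mono:
  assumes "0 \<le> a" "a < b"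
  shows "deriv f a < deriv f b"
proof (rule DERIV_pos_imp_increasing_open[OF assms(2)])
  fix x assume x: "a < x" "x < b"
  have "deriv f differentiable (at x within - {0})"
    using adm x assms unfolding admissible_nonlinearity_def differentiable_on_def by auto
  moreover have "at x within - {0} = at x"
    using x assms by (intro at_within_open) auto
  ultimately have "(deriv f has_real_derivative deriv (deriv f) x) (at x)"
    by (simp add: DERIV_deriv_iff_real_differentiable)
  moreover have "deriv (deriv f) x > 0"
    using adm x assms by (auto simp: admissible_nonlinearity_def)
  ultimately show "\<exists>y. (deriv f has_real_derivative y) (at x) \<and> y > 0" by blast
qed (use admissible_deriv_continuous continuous_on_subset in blast)

lemma admissible_deriv_mono: "0 \<le> a \<Longrightarrow> a \<le> b \<Longrightarrow> deriv f a \<le> deriv f b"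
  using admissible_deriv_strict_mono[of a b] by (cases "a = b") auto

lemma admissible_deriv_nonneg: "x \<ge> 0 \<Longrightarrow> deriv f x \<ge> 0"
proof -
  have "closed (deriv f -` {0..})"
    using admissible_deriv_continuous by (simp add: closed_vimage continuous_on_closed_vimage)
  moreover have "{0<..} \<subseteq> deriv f -` {0..}"
    using adm by (auto simp: admissible_nonlinearity_def less_imp_le)
  ultimately have "closure {0<..} \<subseteq> deriv f -` {0..}" by (intro closure_minimal)
  then show "x \<ge> 0 \<Longrightarrow> deriv f x \<ge> 0" by auto
qed

text \<open>The tangent is taken at the larger point, which is where the stability weight sits. With
  \<open>a = 0\<close> it gives \<open>f b < deriv f b * b\<close>.\<close>

lemma admissible_strict_convex:
  assumes "0 \<le> a" "a < b"
  shows "f b - f a < deriv f b * (b - a)"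
proof -
  obtain z where z: "a < z" "z < b" "f b - f a = (b - a) * deriv f z"
    using MVT2[OF assms(2), of f "deriv f"] admissible_DERIV by auto
  then show ?thesis
    using admissible_deriv_strict_mono[of z b] assms by (simp add: mult.commute)
qed

section \<open>Positivity and ordering forced by stability\<close>

lemma stable_no_strict_subsolution:
  assumes v: "radial_poisson n v v' g" and card: "CARD('n) = Suc n"
    and stable: "stable_solution f (\<lambda>x::real^'n. w (norm x))" and w: "continuous_on {0..} w"
    and R: "R > 0" "v R = 0"
    and pos: "\<And>r. 0 \<le> r \<Longrightarrow> r < R \<Longrightarrow> v r > 0"
    and less: "\<And>r. 0 \<le> r \<Longrightarrow> r < R \<Longrightarrow> g r < deriv f (w r) * v r"
  shows False
proof -
  interpret radial_poisson n v v' g by fact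
  have "continuous_on {0..} (\<lambda>r. deriv f (w r))"
    by (rule continuous_on_compose2[OF admissible_deriv_continuous w]) auto
  from exists_destabilizing_function[OF _ R pos less this, where 'a = "real^'n"] card
  obtain \<phi> :: "real^'n \<Rightarrow> real" and \<psi> where
    "\<And>x. GDERIV \<phi> x :> \<psi> x" "continuous_on UNIV \<psi>" "compact (closure {x. \<phi> x \<noteq> 0})"
    "(\<integral>x. ((norm (\<psi> x))\<^sup>2 - deriv f (w (norm x)) * (\<phi> x)\<^sup>2) \<partial>lborel) < 0"
    by auto
  with stable show False
    unfolding stable_solution_def by fastforce
qed

lemma stable_imp_pos:
  assumes v: "radial_poisson n v v' (\<lambda>r. f (v r))" and card: "CARD('n) = Suc n"
    and stable: "stable_solution f (\<lambda>x::real^'n. v (norm x))"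
    and v0: "v 0 > 0" and r: "r \<ge> 0"
  shows "v r > 0"
proof (rule ccontr)
  interpret radial_poisson n v v' "\<lambda>r. f (v r)" by fact
  assume "\<not> v r > 0"
  then have "v r \<le> 0" by simp
  from first_zero_obtain[OF cont_v v0 r this] obtain R where
    R: "R > 0" "v R = 0" "\<And>s. 0 \<le> s \<Longrightarrow> s < R \<Longrightarrow> v s > 0" by blast
  show False
  proof (rule stable_no_strict_subsolution[OF v card stable cont_v R])
    show "f (v s) < deriv f (v s) * v s" if "0 \<le> s" "s < R" for s
      using admissible_strict_convex[of 0 "v s"] R(3)[OF that] admissible_zero by simp
  qed
qed

lemma stable_imp_ordered:
  assumes v: "radial_poisson n v v' (\<lambda>r. f (v r))" and w: "radial_poisson n w w' (\<lambda>r. f (w r))"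
    and card: "CARD('n) = Suc n"
    and stable: "stable_solution f (\<lambda>x::real^'n. w (norm x))"
    and v0: "0 < v 0" "v 0 < w 0" and r: "r \<ge> 0"
  shows "0 < v r \<and> v r < w r"
proof (rule ccontr)
  interpret v: radial_poisson n v v' "\<lambda>r. f (v r)" by fact
  interpret w: radial_poisson n w w' "\<lambda>r. f (w r)" by fact
  \<comment> \<open>The minimum merges the two ways the claim can fail: before the first zero of
    \<open>p\<close> both \<open>v\<close> and \<open>w - v\<close> are positive, and at that zero
    one of them vanishes.\<close>
  define p where "p = (\<lambda>r. min (v r) (w r - v r))"
  have p: "continuous_on {0..} p"
    unfolding p_def by (intro continuous_intros v.cont_v w.cont_v)
  have p0: "p 0 > 0" using v0 by (auto simp: p_def)
  assume "\<not> (0 < v r \<and> v r < w r)"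
  then have "p r \<le> 0" by (auto simp: p_def)
  from first_zero_obtain[OF p p0 r this]
  obtain R where R: "R > 0" "p R = 0" and p_pos: "\<And>s. 0 \<le> s \<Longrightarrow> s < R \<Longrightarrow> p s > 0"
    by blast
  have pos: "0 < v s" "v s < w s" if "0 \<le> s" "s < R" for s
    using p_pos[OF that] by (auto simp: p_def)
  from R consider "v R = 0" | "w R - v R = 0" by (auto simp: p_def min_def split: if_splits)
  then show False
  proof cases
    case 1
    show False
    proof (rule stable_no_strict_subsolution[OF v card stable w.cont_v R(1) 1 pos(1)])
      fix s assume s: "0 \<le> s" "s < R"
      have "f (v s) < deriv f (v s) * v s"
        using admissible_strict_convex[of 0 "v s"] pos[OF s] admissible_zero by simp
      also have "\<dots> \<le> deriv f (w s) * v s"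
        using pos[OF s] by (intro mult_right_mono admissible_deriv_mono) auto
      finally show "f (v s) < deriv f (w s) * v s" .
    qed
  next
    case 2
    show False
    proof (rule stable_no_strict_subsolution[OF radial_poisson_diff[OF w v] card stable w.cont_v R(1) 2])
      show "w s - v s > 0" "f (w s) - f (v s) < deriv f (w s) * (w s - v s)"
        if "0 \<le> s" "s < R" for s
        using pos[OF that] admissible_strict_convex[of "v s" "w s"] by auto
    qed
  qed
qed

section \<open>Stability under decrease of the solution and under limits\<close>

lemma continuous_radial_weight:
  assumes "continuous_on {0..} w"
  shows "continuous_on UNIV (\<lambda>x::'a::real_normed_vector. deriv f (w (norm x)))"
proof -
  have "continuous_on UNIV (\<lambda>x::'a. w (norm x))"
    by (rule continuous_on_compose2[OF assms]) (auto intro!: continuous_intros)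
  then show ?thesis
    by (rule continuous_on_compose2[OF admissible_deriv_continuous]) auto
qed

lemma stable_solution_mono:
  assumes stable: "stable_solution f (\<lambda>x::real^'n. w (norm x))"
    and cont: "continuous_on {0..} v" "continuous_on {0..} w"
    and le: "\<And>r. r \<ge> 0 \<Longrightarrow> 0 \<le> v r \<and> v r \<le> w r"
  shows "stable_solution f (\<lambda>x::real^'n. v (norm x))"
  unfolding stable_solution_def
proof (intro allI impI)
  fix \<phi> :: "real^'n \<Rightarrow> real" and \<psi>
  assume asm: "(\<forall>x. GDERIV \<phi> x :> \<psi> x) \<and> continuous_on UNIV \<psi> \<and> compact (closure {x. \<phi> x \<noteq> 0})"
  then have "0 \<le> (\<integral>x. ((norm (\<psi> x))\<^sup>2 - deriv f (w (norm x)) * (\<phi> x)\<^sup>2) \<partial>lborel)"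
    using stable unfolding stable_solution_def by blast
  also have "\<dots> \<le> (\<integral>x. ((norm (\<psi> x))\<^sup>2 - deriv f (v (norm x)) * (\<phi> x)\<^sup>2) \<partial>lborel)"
  proof (rule integral_mono)
    show "integrable lborel (\<lambda>x. (norm (\<psi> x))\<^sup>2 - deriv f (w (norm x)) * (\<phi> x)\<^sup>2)"
      "integrable lborel (\<lambda>x. (norm (\<psi> x))\<^sup>2 - deriv f (v (norm x)) * (\<phi> x)\<^sup>2)"
      using asm by (intro test_function_integrable(2) continuous_radial_weight cont; simp)+
    show "(norm (\<psi> x))\<^sup>2 - deriv f (w (norm x)) * (\<phi> x)\<^sup>2
        \<le> (norm (\<psi> x))\<^sup>2 - deriv f (v (norm x)) * (\<phi> x)\<^sup>2" for x
      using le[of "norm x"] by (intro diff_left_mono mult_right_mono admissible_deriv_mono) auto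
  qed
  finally show "0 \<le> (\<integral>x. ((norm (\<psi> x))\<^sup>2 - deriv f (v (norm x)) * (\<phi> x)\<^sup>2) \<partial>lborel)" .
qed

text \<open>The common bound \<open>B\<close> confines all values on \<open>{0..r}\<close> to one
  interval, where \<open>f\<close> has a single Lipschitz constant. The Gronwall estimate for
  \<open>v k - w\<close> then holds with a factor independent of \<open>k\<close>.\<close>

lemma radial_solution_tendsto:
  assumes w: "radial_poisson n w w' (\<lambda>r. f (w r))"
    and v: "\<And>k::nat. radial_poisson n (v k) (v' k) (\<lambda>r. f (v k r))"
    and bound: "\<And>k r. r \<ge> 0 \<Longrightarrow> \<bar>v k r\<bar> \<le> B"
    and lim: "(\<lambda>k. v k 0) \<longlonglongrightarrow> w 0" and r: "r \<ge> 0"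
  shows "(\<lambda>k. v k r) \<longlonglongrightarrow> w r"
proof -
  interpret w: radial_poisson n w w' "\<lambda>r. f (w r)" by fact
  have "bounded (w ` {0..r})"
    by (intro compact_imp_bounded compact_continuous_image continuous_on_subset[OF w.cont_v]) auto
  then obtain M0 where M0: "\<And>s. 0 \<le> s \<Longrightarrow> s \<le> r \<Longrightarrow> \<bar>w s\<bar> \<le> M0"
    unfolding bounded_iff by fastforce
  define M where "M = max M0 B"
  have "bounded (deriv f ` {-M..M})"
    by (intro compact_imp_bounded compact_continuous_image continuous_on_subset[OF admissible_deriv_continuous]) auto
  then obtain L0 where L0: "\<And>s. s \<in> {-M..M} \<Longrightarrow> norm (deriv f s) \<le> L0"
    unfolding bounded_iff by fastforce
  define L where "L = max L0 0"
  have lip: "norm (f x - f y) \<le> L * norm (x - y)" if "x \<in> {-M..M}" "y \<in> {-M..M}" for x y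
  proof (rule field_differentiable_bound)
    show "(f has_real_derivative deriv f z) (at z within {-M..M})" for z
      using admissible_DERIV by (rule has_field_derivative_at_within)
    show "norm (deriv f z) \<le> L" if "z \<in> {-M..M}" for z
      using L0[OF that] by (simp add: L_def)
  qed (use that in auto)
  have est: "(v k r - w r)\<^sup>2 \<le> (v k 0 - w 0)\<^sup>2 * exp ((1 + L) * r)" for k
  proof -
    interpret d: radial_poisson n "\<lambda>r. v k r - w r" "\<lambda>r. v' k r - w' r" "\<lambda>r. f (v k r) - f (w r)"
      by (rule radial_poisson_diff[OF v w])
    show ?thesis
    proof (rule d.gronwall)
      fix s assume s: "0 \<le> s" "s \<le> r"
      have "\<bar>v k s\<bar> \<le> M" "\<bar>w s\<bar> \<le> M"
        using bound[of s k] M0[of s] s by (auto simp: M_def)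
      then show "\<bar>f (v k s) - f (w s)\<bar> \<le> L * \<bar>v k s - w s\<bar>"
        using lip[of "v k s" "w s"] by (simp add: abs_le_iff minus_le_iff)
    qed (use r in \<open>auto simp: L_def\<close>)
  qed
  have "(\<lambda>k. (v k 0 - w 0)\<^sup>2 * exp ((1 + L) * r)) \<longlonglongrightarrow> (w 0 - w 0)\<^sup>2 * exp ((1 + L) * r)"
    by (intro tendsto_intros lim)
  then have exp_lim: "(\<lambda>k. (v k 0 - w 0)\<^sup>2 * exp ((1 + L) * r)) \<longlonglongrightarrow> 0" by simp
  have "(\<lambda>k. (v k r - w r)\<^sup>2) \<longlonglongrightarrow> 0"
    by (rule Lim_null_comparison[OF _ exp_lim]) (simp add: est)
  from tendsto_real_sqrt[OF this] have "(\<lambda>k. v k r - w r) \<longlonglongrightarrow> 0"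
    by (simp add: tendsto_rabs_zero_iff)
  then show ?thesis by (simp add: LIM_zero_iff)
qed

text \<open>Stability makes each \<open>v k\<close> positive, so it is largest at the origin and
  lies between 0 and \<open>B\<close>. This one bound yields both the pointwise convergence and, as
  \<open>deriv f\<close> is increasing there, an integrable majorant for dominated
  convergence.\<close>

lemma stable_solution_limit:
  assumes w: "radial_poisson n w w' (\<lambda>r. f (w r))"
    and v: "\<And>k::nat. radial_poisson n (v k) (v' k) (\<lambda>r. f (v k r))"
    and card: "CARD('n) = Suc n"
    and stable: "\<And>k. stable_solution f (\<lambda>x::real^'n. v k (norm x))"
    and v0: "\<And>k. 0 < v k 0" "\<And>k. v k 0 \<le> B"
    and lim: "(\<lambda>k. v k 0) \<longlonglongrightarrow> w 0"
  shows "stable_solution f (\<lambda>x::real^'n. w (norm x))"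
  unfolding stable_solution_def
proof (intro allI impI)
  interpret w: radial_poisson n w w' "\<lambda>r. f (w r)" by fact
  interpret v: radial_poisson n "v k" "v' k" "\<lambda>r. f (v k r)" for k by (rule v)
  have pos: "v k r > 0" if "r \<ge> 0" for k r
    by (rule stable_imp_pos[OF v card stable v0(1) that])
  have le: "v k r \<le> B" if "r \<ge> 0" for k r
  proof -
    have "v k r \<le> v k 0"
      using that by (intro v.v_le_v_0 less_imp_le[OF admissible_pos] pos)
    also have "\<dots> \<le> B" by (rule v0(2))
    finally show ?thesis .
  qed
  have "B > 0" using v0[of 0] by linarith
  fix \<phi> :: "real^'n \<Rightarrow> real" and \<psi>
  assume asm: "(\<forall>x. GDERIV \<phi> x :> \<psi> x) \<and> continuous_on UNIV \<psi> \<and> compact (closure {x. \<phi> x \<noteq> 0})"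
  have "(\<lambda>k. \<integral>x. ((norm (\<psi> x))\<^sup>2 - deriv f (v k (norm x)) * (\<phi> x)\<^sup>2) \<partial>lborel)
    \<longlonglongrightarrow> (\<integral>x. ((norm (\<psi> x))\<^sup>2 - deriv f (w (norm x)) * (\<phi> x)\<^sup>2) \<partial>lborel)"
  proof (rule integral_dominated_convergence)
    \<comment> \<open>The majorant is the same quadratic expression with the constant weight
      \<open>- deriv f B\<close>.\<close>
    show "integrable lborel (\<lambda>x. (norm (\<psi> x))\<^sup>2 - (- deriv f B) * (\<phi> x)\<^sup>2)"
      using asm by (intro test_function_integrable(2)) auto
    show "(\<lambda>x. (norm (\<psi> x))\<^sup>2 - deriv f (w (norm x)) * (\<phi> x)\<^sup>2) \<in> borel_measurable lborel"
      "(\<lambda>x. (norm (\<psi> x))\<^sup>2 - deriv f (v k (norm x)) * (\<phi> x)\<^sup>2) \<in> borel_measurable lborel" for k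
      using asm by (intro borel_measurable_integrable test_function_integrable(2)
          continuous_radial_weight w.cont_v v.cont_v; simp)+
    show "AE x in lborel. (\<lambda>k. (norm (\<psi> x))\<^sup>2 - deriv f (v k (norm x)) * (\<phi> x)\<^sup>2)
        \<longlonglongrightarrow> (norm (\<psi> x))\<^sup>2 - deriv f (w (norm x)) * (\<phi> x)\<^sup>2"
    proof (intro AE_I2 tendsto_intros)
      fix x :: "real^'n"
      have "(\<lambda>k. v k (norm x)) \<longlonglongrightarrow> w (norm x)"
        by (rule radial_solution_tendsto[OF w v _ lim]) (use pos le in \<open>auto simp: abs_of_pos\<close>)
      then show "(\<lambda>k. deriv f (v k (norm x))) \<longlonglongrightarrow> deriv f (w (norm x))"
        using admissible_deriv_continuous by (auto intro: continuous_on_tendsto_compose)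
    qed
    show "AE x in lborel. norm ((norm (\<psi> x))\<^sup>2 - deriv f (v k (norm x)) * (\<phi> x)\<^sup>2)
        \<le> (norm (\<psi> x))\<^sup>2 - (- deriv f B) * (\<phi> x)\<^sup>2" for k
    proof (intro AE_I2)
      fix x :: "real^'n"
      have "0 \<le> deriv f (v k (norm x))" "deriv f (v k (norm x)) \<le> deriv f B"
        using pos[of "norm x" k] le[of "norm x" k]
        by (auto intro!: admissible_deriv_nonneg admissible_deriv_mono simp: less_imp_le)
      then have "0 \<le> deriv f (v k (norm x)) * (\<phi> x)\<^sup>2"
        "deriv f (v k (norm x)) * (\<phi> x)\<^sup>2 \<le> deriv f B * (\<phi> x)\<^sup>2"
        by (auto intro: mult_right_mono)
      then show "norm ((norm (\<psi> x))\<^sup>2 - deriv f (v k (norm x)) * (\<phi> x)\<^sup>2)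
        \<le> (norm (\<psi> x))\<^sup>2 - (- deriv f B) * (\<phi> x)\<^sup>2"
        using zero_le_power2[of "norm (\<psi> x)"] by (simp only: real_norm_def abs_le_iff) linarith
    qed
  qed
  moreover have "0 \<le> (\<integral>x. ((norm (\<psi> x))\<^sup>2 - deriv f (v k (norm x)) * (\<phi> x)\<^sup>2) \<partial>lborel)" for k
    using stable[of k] asm unfolding stable_solution_def by blast
  ultimately show "0 \<le> (\<integral>x. ((norm (\<psi> x))\<^sup>2 - deriv f (w (norm x)) * (\<phi> x)\<^sup>2) \<partial>lborel)"
    using LIMSEQ_le_const by blast
qed

end

section \<open>The set of stable central values\<close>

lemma radial_solution_imp_radial_poisson:
  assumes sol: "radial_solution N f \<alpha> v" and f: "admissible_nonlinearity f" and N: "N \<ge> 2"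
  shows "\<exists>v'. radial_poisson (N - 1) v v' (\<lambda>r. f (v r))"
proof -
  from sol obtain v' v'' where
    v: "\<And>r. r \<ge> 0 \<Longrightarrow> (v has_real_derivative v' r) (at r within {0..})" and
    v': "\<And>r. r > 0 \<Longrightarrow> (v' has_real_derivative v'' r) (at r)" and
    ode: "\<And>r. r > 0 \<Longrightarrow> v'' r + (real N - 1) / r * v' r + f (v r) = 0" and v'0: "v' 0 = 0"
    unfolding radial_solution_def by blast
  have "radial_poisson (N - 1) v v' (\<lambda>r. f (v r))"
  proof
    show "continuous_on {0..} (\<lambda>r. f (v r))"
      using DERIV_continuous_on[of "{0..}" v v'] v
      by (intro continuous_on_compose2[OF admissible_continuous[OF f]]) auto
    show "(v' has_real_derivative - (real (N - 1) / r * v' r) - f (v r)) (at r)" if "r > 0" for r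
    proof (rule DERIV_cong[OF v'[OF that]])
      show "v'' r = - (real (N - 1) / r * v' r) - f (v r)"
        using ode[OF that] N by (simp add: of_nat_diff)
    qed
  qed (use v v'0 N in auto)
  then show ?thesis by blast
qed

theorem theorem1p1:
  fixes f :: "real \<Rightarrow> real"
    and u :: "real \<Rightarrow> real \<Rightarrow> real"
  assumes N: "CARD('n::finite) \<ge> 3"
    and f: "admissible_nonlinearity f"
    and u: "\<And>\<alpha>. \<alpha> > 0 \<Longrightarrow> radial_solution CARD('n) f \<alpha> (\<lambda>r. u r \<alpha>)"
  shows "(\<forall>\<alpha>>0. stable_solution f (\<lambda>x::real^'n. u (norm x) \<alpha>) \<longrightarrow> first_zero (\<lambda>r. u r \<alpha>) = \<infinity>) \<and>
    ((\<forall>\<alpha>>0. unstable_solution f (\<lambda>x::real^'n. u (norm x) \<alpha>)) \<or>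
     (\<forall>\<alpha>>0. stable_solution f (\<lambda>x::real^'n. u (norm x) \<alpha>)) \<and>
       (\<forall>r>0. strict_mono_on {0<..} (\<lambda>\<alpha>. u r \<alpha>)) \<or>
     (\<exists>\<alpha>\<^sub>0>0.
       (\<forall>\<alpha>\<in>{0<..\<alpha>\<^sub>0}. stable_solution f (\<lambda>x::real^'n. u (norm x) \<alpha>)) \<and>
       (\<forall>\<alpha>>\<alpha>\<^sub>0. unstable_solution f (\<lambda>x::real^'n. u (norm x) \<alpha>)) \<and>
       (\<forall>r>0. strict_mono_on {0<..<\<alpha>\<^sub>0} (\<lambda>\<alpha>. u r \<alpha>))))"
proof -
  define n where "n = CARD('n) - 1"
  have card: "CARD('n) = Suc n" using N by (simp add: n_def)
  have "\<forall>\<alpha>. \<exists>v'. \<alpha> > 0 \<longrightarrow> radial_poisson n (\<lambda>r. u r \<alpha>) v' (\<lambda>r. f (u r \<alpha>))"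
    using radial_solution_imp_radial_poisson[OF u f] N unfolding n_def by fastforce
  then obtain u' where u': "\<And>\<alpha>. \<alpha> > 0 \<Longrightarrow> radial_poisson n (\<lambda>r. u r \<alpha>) (u' \<alpha>) (\<lambda>r. f (u r \<alpha>))"
    by metis
  have u0: "u 0 \<alpha> = \<alpha>" if "\<alpha> > 0" for \<alpha>
    using u[OF that] by (auto simp: radial_solution_def)
  define S where "S = {\<alpha>. \<alpha> > 0 \<and> stable_solution f (\<lambda>x::real^'n. u (norm x) \<alpha>)}"
  have zero: "first_zero (\<lambda>r. u r \<alpha>) = \<infinity>" if "\<alpha> \<in> S" for \<alpha>
  proof -
    have "u r \<alpha> > 0" if "r \<ge> 0" for r
      using stable_imp_pos[OF f u' card, of \<alpha> r] u0 \<open>\<alpha> \<in> S\<close> that by (simp add: S_def)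
    then have "{r. 0 \<le> r \<and> u r \<alpha> = 0} = {}" by force
    then show ?thesis unfolding first_zero_def by (simp only: image_empty Inf_empty top_ereal_def)
  qed
  have ordered: "0 < u r \<alpha> \<and> u r \<alpha> < u r \<beta>" if "\<beta> \<in> S" "0 < \<alpha>" "\<alpha> < \<beta>" "r \<ge> 0" for \<alpha> \<beta> r
    using stable_imp_ordered[OF f u' u' card, of \<alpha> \<beta> r] that u0 by (simp add: S_def)
  have down: "\<alpha> \<in> S" if "\<beta> \<in> S" "0 < \<alpha>" "\<alpha> < \<beta>" for \<alpha> \<beta>
  proof -
    have "stable_solution f (\<lambda>x::real^'n. u (norm x) \<alpha>)"
      by (rule stable_solution_mono[OF f, where w = "\<lambda>r. u r \<beta>"])
         (use that ordered[OF that] u' radial_poisson.cont_v[OF u'] in \<open>auto simp: S_def less_imp_le\<close>)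
    with that show ?thesis by (simp add: S_def)
  qed
  have mono: "strict_mono_on T (\<lambda>\<alpha>. u r \<alpha>)" if "T \<subseteq> S" "r > 0" for T r
    using that ordered by (auto simp: strict_mono_on_def S_def subset_iff)
  \<comment> \<open>These cases give (I), (II) and (III) in turn; only the last needs the supremum
    of \<open>S\<close>.\<close>
  consider "S = {}" | "S = {0<..}" | "S \<noteq> {}" "S \<noteq> {0<..}" by blast
  then have "(\<forall>\<alpha>>0. \<alpha> \<notin> S) \<or> ((\<forall>\<alpha>>0. \<alpha> \<in> S) \<and> (\<forall>r>0. strict_mono_on {0<..} (\<lambda>\<alpha>. u r \<alpha>))) \<or>
    (\<exists>\<alpha>\<^sub>0>0. (\<forall>\<alpha>\<in>{0<..\<alpha>\<^sub>0}. \<alpha> \<in> S) \<and>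
      (\<forall>\<alpha>>\<alpha>\<^sub>0. unstable_solution f (\<lambda>x::real^'n. u (norm x) \<alpha>)) \<and>
      (\<forall>r>0. strict_mono_on {0<..<\<alpha>\<^sub>0} (\<lambda>\<alpha>. u r \<alpha>)))"
  proof cases
    case 3
    define a where "a = Sup S"
    \<comment> \<open>As \<open>S\<close> is closed downwards, a positive value outside it bounds it
      from above.\<close>
    obtain b where b: "b > 0" "b \<notin> S" using 3 by (auto simp: S_def)
    have "\<alpha> \<le> b" if "\<alpha> \<in> S" for \<alpha>
      using down[of \<alpha> b] that b by force
    then have bdd: "bdd_above S" by (rule bdd_aboveI)
    have upper: "\<alpha> \<le> a" if "\<alpha> \<in> S" for \<alpha>
      unfolding a_def using bdd that by (rule cSup_upper[rotated])
    have "a > 0" using 3 upper by (force simp: S_def)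
    have below: "\<alpha> \<in> S" if "0 < \<alpha>" "\<alpha> < a" for \<alpha>
    proof -
      obtain \<beta> where "\<beta> \<in> S" "\<alpha> < \<beta>"
        using \<open>\<alpha> < a\<close> less_cSup_iff[OF 3(1) bdd, of \<alpha>] unfolding a_def by blast
      with down that show ?thesis by blast
    qed
    \<comment> \<open>A sequence of stable values tending to \<open>a\<close> from below. The double
      \<open>Suc\<close> keeps the first term positive; with a single one it would be
      \<open>0\<close>.\<close>
    define s where "s = (\<lambda>k. a * (1 - inverse (real (Suc (Suc k)))))"
    have s: "0 < s k" "s k < a" for k
      using \<open>a > 0\<close> by (auto simp: s_def field_simps intro!: add_pos_nonneg)
    have "(\<lambda>k. inverse (real (Suc (Suc k)))) \<longlonglongrightarrow> 0"
      using LIMSEQ_Suc[OF LIMSEQ_inverse_real_of_nat] by simp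
    then have "s \<longlonglongrightarrow> a * (1 - 0)"
      unfolding s_def by (intro tendsto_mult tendsto_diff tendsto_const)
    then have "s \<longlonglongrightarrow> a" by simp
    have "stable_solution f (\<lambda>x::real^'n. u (norm x) a)"
    proof (rule stable_solution_limit[OF f u'[OF \<open>a > 0\<close>] u'[OF s(1)] card])
      show "stable_solution f (\<lambda>x::real^'n. u (norm x) (s k))" for k
        using below[OF s] by (simp add: S_def)
      show "0 < u 0 (s k)" "u 0 (s k) \<le> a" for k
        using s[of k] u0 by auto
      show "(\<lambda>k. u 0 (s k)) \<longlonglongrightarrow> u 0 a"
        using \<open>s \<longlonglongrightarrow> a\<close> \<open>a > 0\<close> s u0 by simp
    qed
    with \<open>a > 0\<close> have "a \<in> S" by (simp add: S_def)
    show ?thesis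
    proof (intro disjI2 exI[of _ a] conjI ballI allI impI)
      show "\<alpha> \<in> S" if "\<alpha> \<in> {0<..a}" for \<alpha>
        using that below \<open>a \<in> S\<close> by (cases "\<alpha> = a") auto
      show "unstable_solution f (\<lambda>x::real^'n. u (norm x) \<alpha>)" if "\<alpha> > a" for \<alpha>
        using upper[of \<alpha>] that \<open>a > 0\<close> by (auto simp: S_def unstable_solution_def)
      show "strict_mono_on {0<..<a} (\<lambda>\<alpha>. u r \<alpha>)" if "r > 0" for r
        by (rule mono[OF _ that]) (use below in auto)
    qed fact
  qed (use mono in auto)
  moreover have "\<alpha> \<in> S \<longleftrightarrow> stable_solution f (\<lambda>x::real^'n. u (norm x) \<alpha>)" if "\<alpha> > 0" for \<alpha>
    using that by (simp add: S_def)
  ultimately show ?thesis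
    using zero by (simp add: unstable_solution_def)
qed

end
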